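(* Let $\Gamma=\forall x\forall y:\phi(x,y)\wedge\bigwedge_{k\in[m]}\forall x\exists y:\beta_k(x,y)$ be an $\mathbf{FO}^2$ sentence in Scott normal form and $\Delta=\{e_1,\dots,e_n\}$ a finite non-empty domain. Let $i\in[n]$, let $\theta$ be a context of a call $\textsc{Stage-I}(i,\theta)$ of the Two-Stage Compilation algorithm (described in the context), and let $C$ and $C'$ be the circuits returned by $\textsc{Stage-I}(i+1,\theta\wedge\tau(e_i))$ and $\textsc{Stage-I}(i+1,\theta\wedge\tau'(e_i))$, respectively, where $\tau$ and $\tau'$ are two valid unary types for $e_i$. If - for every $k\in[m]$, $\beta_k(x,x)\in\tau$ iff $\beta_k(x,x)\in\tau'$; and - for every unary type $\tau''\in\mathcal U$, $\mathcal B(\tau,\tau'')=\mathcal B(\tau',\tau'')$, then $C$ and $C'$ are equivalent (have the same satisfying assignments).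
   Context: Logic. First-order logic is function-free, constant-free and without equality. Vocabularies are finite, with predicates of arity 1 or 2. In the Scott normal form, $\phi$ is quantifier-free with variables among $x,y$ and each $\beta_k(x,y)$ is a single binary atom. Ground atoms over $\Delta$ are the propositional variables. Circuits. An NNF circuit is a labelled DAG with internal nodes $\wedge,\vee$, leaves that are literals (or the constants $\top,\bot$), and a unique output node. Types. A unary type $\tau$ is a maximally consistent set of literals over the atoms $P(x)$ ($P$ unary in $\Gamma$) and $R(x,x)$ ($R$ binary in $\Gamma$). A binary type $\pi$ is a maximally consistent set of literals over the atoms $R(x,y),R(y,x)$ ($R$ binary in $\Gamma$). Types are identified with the conjunctions $\tau(x)$, $\pi(x,y)$ of their literals. $\tau$ is valid if $\tau(x)\models\phi(x,x)$; $\mathcal U$ is the set of valid unary types. For $\tau,\tau'\in\mathcal U$, $\mathcal B(\tau,\tau')$ is the set of binary types $\pi$ with $\tau(x)\wedge\tau'(y)\wedge\pi(x,y)\models\phi(x,y)\wedge\phi(y,x)$. Algorithm. A context $\theta$ is the conjunction of the ground type formulas chosen so far along the current recursion branch (for $\textsc{Stage-I}(i,\theta)$: one valid unary type for each of $e_1,\dots,e_{i-1}$). $\textsc{Extendable}(\theta)$ holds iff there is a model $\mathcal A$ over $\Delta$ with $\mathcal A\models\Gamma\wedge\theta$. $\textsc{Or}(S)$ and $\textsc{And}(S)$ create an $\vee$-node (resp. $\wedge$-node) with children $S$; empty $\textsc{Or}$ is $\bot$ and empty $\textsc{And}$ is $\top$. Two-Stage Compilation returns $\textsc{Stage-I}(1,\top)$,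 where: - $\textsc{Stage-I}(i,\theta)$: if $i=n+1$, return $\textsc{Stage-II}((1,2),\theta)$. Otherwise return $\textsc{Or}$ of the set of all nodes $\textsc{And}(\textsc{And}(\tau(e_i)),\textsc{Stage-I}(i+1,\theta\wedge\tau(e_i)))$, over all $\tau\in\mathcal U$ for which $\textsc{Extendable}(\theta\wedge\tau(e_i))$ holds, where $\textsc{And}(\tau(e_i))$ is the $\wedge$-node over the literals of $\tau(e_i)$. - $\textsc{Stage-II}((i,j),\theta)$: if $i=n$, return $\top$. Otherwise let $\tau_i,\tau_j$ be the unary types assigned to $e_i,e_j$ in $\theta$ and return $\textsc{Or}$ of the set of all nodes $\textsc{And}(\textsc{And}(\pi(e_i,e_j)),\textsc{Stage-II}(\mathrm{next}(i,j),\theta\wedge\pi(e_i,e_j)))$, over all $\pi\in\mathcal B(\tau_i,\tau_j)$ for which $\textsc{Extendable}(\theta\wedge\pi(e_i,e_j))$ holds. Here $\mathrm{next}(i,j)=(i,j+1)$ if $j<n$ and $(i+1,i+2)$ if $j=n$. Recursive calls are made only for contexts passing the $\textsc{Extendable}$ test. *)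

theory Defs
  imports Main "HOL-Library.FSet"
begin

section \<open>Formulas and structures\<close>

text \<open>
  Atoms over unary predicates \<open>'u\<close>, binary predicates \<open>'b\<close> and terms \<open>'t\<close>.  The terms are
  variables in formulas and domain elements in ground formulas.
\<close>

datatype (upreds_atom: 'u, bpreds_atom: 'b, terms_atom: 't) atom =
    Unary 'u 't
  | is_Binary: Binary 'b 't 't

datatype 'a lit = Pos 'a | Neg 'a

datatype (upreds: 'u, bpreds: 'b, terms: 't) qf =
    Truth
  | Falsity
  | Atom "('u, 'b, 't) atom"
  | Neg_qf "('u, 'b, 't) qf"
  | Conj "('u, 'b, 't) qf" "('u, 'b, 't) qf"
  | Disj "('u, 'b, 't) qf" "('u, 'b, 't) qf"

datatype var = X | Y

text \<open>The substitution of \<open>s\<close> for \<open>x\<close> and \<open>t\<close> for \<open>y\<close>.\<close>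

definition sub :: "'t \<Rightarrow> 't \<Rightarrow> var \<Rightarrow> 't" where
  "sub s t v = (case v of X \<Rightarrow> s | Y \<Rightarrow> t)"

definition inst_atom :: "'t \<Rightarrow> 't \<Rightarrow> ('u, 'b, var) atom \<Rightarrow> ('u, 'b, 't) atom" where
  "inst_atom s t = map_atom id id (sub s t)"

definition inst_lits :: "'t \<Rightarrow> 't \<Rightarrow> ('u, 'b, var) atom lit set \<Rightarrow> ('u, 'b, 't) atom lit set" where
  "inst_lits s t L = map_lit (inst_atom s t) ` L"

definition inst_qf :: "'t \<Rightarrow> 't \<Rightarrow> ('u, 'b, var) qf \<Rightarrow> ('u, 'b, 't) qf" where
  "inst_qf s t = map_qf id id (sub s t)"

record ('u, 'b, 'd) struct =
  universe :: "'d set"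
  uinterp :: "'u \<Rightarrow> 'd set"
  binterp :: "'b \<Rightarrow> ('d \<times> 'd) set"

definition is_struct :: "('u, 'b, 'd) struct \<Rightarrow> bool" where
  "is_struct A \<longleftrightarrow> universe A \<noteq> {} \<and> (\<forall>P. uinterp A P \<subseteq> universe A) \<and>
    (\<forall>R. binterp A R \<subseteq> universe A \<times> universe A)"

primrec holds_atom :: "('u, 'b, 'd) struct \<Rightarrow> ('t \<Rightarrow> 'd) \<Rightarrow> ('u, 'b, 't) atom \<Rightarrow> bool" where
  "holds_atom A s (Unary P t) \<longleftrightarrow> s t \<in> uinterp A P"
| "holds_atom A s (Binary R t u) \<longleftrightarrow> (s t, s u) \<in> binterp A R"

primrec holds_lit :: "('u, 'b, 'd) struct \<Rightarrow> ('t \<Rightarrow> 'd) \<Rightarrow> ('u, 'b, 't) atom lit \<Rightarrow> bool" where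
  "holds_lit A s (Pos a) \<longleftrightarrow> holds_atom A s a"
| "holds_lit A s (Neg a) \<longleftrightarrow> \<not> holds_atom A s a"

primrec holds :: "('u, 'b, 'd) struct \<Rightarrow> ('t \<Rightarrow> 'd) \<Rightarrow> ('u, 'b, 't) qf \<Rightarrow> bool" where
  "holds A s Truth \<longleftrightarrow> True"
| "holds A s Falsity \<longleftrightarrow> False"
| "holds A s (Atom a) \<longleftrightarrow> holds_atom A s a"
| "holds A s (Neg_qf f) \<longleftrightarrow> \<not> holds A s f"
| "holds A s (Conj f g) \<longleftrightarrow> holds A s f \<and> holds A s g"
| "holds A s (Disj f g) \<longleftrightarrow> holds A s f \<or> holds A s g"

text \<open>
  Entailment of a quantifier-free formula by a conjunction of literals.  HOL cannot quantify over
  the type of the universe inside a definition; only the values of \<open>x\<close> and \<open>y\<close> matter for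
  quantifier-free formulas, so structures on sets of natural numbers represent all structures.
\<close>

definition entails :: "('u, 'b, var) atom lit set \<Rightarrow> ('u, 'b, var) qf \<Rightarrow> bool" where
  "entails L f \<longleftrightarrow> (\<forall>(A :: ('u, 'b, nat) struct) s.
     is_struct A \<and> (\<forall>v. s v \<in> universe A) \<and> (\<forall>l\<in>L. holds_lit A s l) \<longrightarrow> holds A s f)"


section \<open>Sentences in Scott normal form\<close>

text \<open>
  \<open>\<Gamma>\<close> stands for the sentence \<open>\<forall>x \<forall>y. matrix \<Gamma>\<close> conjoined with \<open>\<forall>x \<exists>y. beta \<Gamma> k\<close> for
  \<open>1 \<le> k \<le> num_ex \<Gamma>\<close>; the values of \<open>beta \<Gamma>\<close> outside this range play no role.
\<close>

record ('u, 'b) scott =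
  matrix :: "('u, 'b, var) qf"
  num_ex :: nat
  beta :: "nat \<Rightarrow> ('u, 'b, var) atom"

definition scott_normal_form :: "('u, 'b) scott \<Rightarrow> bool" where
  "scott_normal_form \<Gamma> \<longleftrightarrow> (\<forall>k\<in>{1..num_ex \<Gamma>}. is_Binary (beta \<Gamma> k))"

definition unary_preds :: "('u, 'b) scott \<Rightarrow> 'u set" where
  "unary_preds \<Gamma> = upreds (matrix \<Gamma>) \<union> (\<Union>k\<in>{1..num_ex \<Gamma>}. upreds_atom (beta \<Gamma> k))"

definition binary_preds :: "('u, 'b) scott \<Rightarrow> 'b set" where
  "binary_preds \<Gamma> = bpreds (matrix \<Gamma>) \<union> (\<Union>k\<in>{1..num_ex \<Gamma>}. bpreds_atom (beta \<Gamma> k))"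

definition models :: "('u, 'b, 'd) struct \<Rightarrow> ('u, 'b) scott \<Rightarrow> bool" where
  "models A \<Gamma> \<longleftrightarrow>
     (\<forall>a\<in>universe A. \<forall>b\<in>universe A. holds A (sub a b) (matrix \<Gamma>)) \<and>
     (\<forall>k\<in>{1..num_ex \<Gamma>}. \<forall>a\<in>universe A. \<exists>b\<in>universe A. holds_atom A (sub a b) (beta \<Gamma> k))"

definition ground_atoms :: "('u, 'b) scott \<Rightarrow> 'e set \<Rightarrow> ('u, 'b, 'e) atom set" where
  "ground_atoms \<Gamma> D =
     {Unary P a | P a. P \<in> unary_preds \<Gamma> \<and> a \<in> D} \<union>
     {Binary R a b | R a b. R \<in> binary_preds \<Gamma> \<and> a \<in> D \<and> b \<in> D}"


section \<open>Types\<close>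

definition lits_over :: "'a set \<Rightarrow> 'a lit set" where
  "lits_over As = Pos ` As \<union> Neg ` As"

definition consistent :: "'a lit set \<Rightarrow> bool" where
  "consistent L \<longleftrightarrow> (\<nexists>a. Pos a \<in> L \<and> Neg a \<in> L)"

definition max_consistent :: "'a set \<Rightarrow> 'a lit set \<Rightarrow> bool" where
  "max_consistent As L \<longleftrightarrow> L \<subseteq> lits_over As \<and> consistent L \<and>
     (\<forall>L'. L \<subseteq> L' \<and> L' \<subseteq> lits_over As \<and> consistent L' \<longrightarrow> L' = L)"

definition unary_types :: "('u, 'b) scott \<Rightarrow> ('u, 'b, var) atom lit set set" where
  "unary_types \<Gamma> = {\<tau>. max_consistent
     ({Unary P X | P. P \<in> unary_preds \<Gamma>} \<union> {Binary R X X | R. R \<in> binary_preds \<Gamma>}) \<tau>}"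

definition binary_types :: "('u, 'b) scott \<Rightarrow> ('u, 'b, var) atom lit set set" where
  "binary_types \<Gamma> = {\<pi>. max_consistent
     ({Binary R X Y | R. R \<in> binary_preds \<Gamma>} \<union> {Binary R Y X | R. R \<in> binary_preds \<Gamma>}) \<pi>}"

definition valid_types :: "('u, 'b) scott \<Rightarrow> ('u, 'b, var) atom lit set set" where
  "valid_types \<Gamma> = {\<tau> \<in> unary_types \<Gamma>. entails \<tau> (inst_qf X X (matrix \<Gamma>))}"

definition compatible ::
  "('u, 'b) scott \<Rightarrow> ('u, 'b, var) atom lit set \<Rightarrow> ('u, 'b, var) atom lit set \<Rightarrow>
   ('u, 'b, var) atom lit set set" where
  "compatible \<Gamma> \<tau> \<tau>' = {\<pi> \<in> binary_types \<Gamma>.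
     entails (\<tau> \<union> inst_lits Y Y \<tau>' \<union> \<pi>)
       (Conj (inst_qf X Y (matrix \<Gamma>)) (inst_qf Y X (matrix \<Gamma>)))}"

lemma finite_unary_preds: "finite (unary_preds \<Gamma>)"
proof -
  have "finite (upreds_atom a)" for a :: "('u, 'b, 't) atom" by (cases a) auto
  moreover from this have "finite (upreds f)" for f :: "('u, 'b, 't) qf" by (induction f) auto
  ultimately show ?thesis by (simp add: unary_preds_def)
qed

lemma finite_binary_preds: "finite (binary_preds \<Gamma>)"
proof -
  have "finite (bpreds_atom a)" for a :: "('u, 'b, 't) atom" by (cases a) auto
  moreover from this have "finite (bpreds f)" for f :: "('u, 'b, 't) qf" by (induction f) auto
  ultimately show ?thesis by (simp add: binary_preds_def)
qed

lemma finite_max_consistent: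
  assumes "finite As"
  shows "finite {L. max_consistent As L}" and "max_consistent As L \<Longrightarrow> finite L"
proof -
  have *: "finite (lits_over As)" using assms by (simp add: lits_over_def)
  show "finite {L. max_consistent As L}"
    by (rule finite_subset[of _ "Pow (lits_over As)"]) (auto simp: max_consistent_def *)
  show "max_consistent As L \<Longrightarrow> finite L"
    using * by (auto simp: max_consistent_def intro: finite_subset)
qed

lemma finite_unary_types: "finite (unary_types \<Gamma>)" "\<tau> \<in> unary_types \<Gamma> \<Longrightarrow> finite \<tau>"
proof -
  have fin: "finite ({Unary P X | P. P \<in> unary_preds \<Gamma>} \<union> {Binary R X X | R. R \<in> binary_preds \<Gamma>})"
    by (simp add: finite_unary_preds finite_binary_preds)
  show "finite (unary_types \<Gamma>)"
    using finite_max_consistent(1)[OF fin] by (simp add: unary_types_def)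
  show "\<tau> \<in> unary_types \<Gamma> \<Longrightarrow> finite \<tau>"
    using finite_max_consistent(2)[OF fin] by (simp add: unary_types_def)
qed

lemma finite_binary_types: "finite (binary_types \<Gamma>)" "\<pi> \<in> binary_types \<Gamma> \<Longrightarrow> finite \<pi>"
proof -
  have fin: "finite ({Binary R X Y | R. R \<in> binary_preds \<Gamma>} \<union> {Binary R Y X | R. R \<in> binary_preds \<Gamma>})"
    by (simp add: finite_binary_preds)
  show "finite (binary_types \<Gamma>)"
    using finite_max_consistent(1)[OF fin] by (simp add: binary_types_def)
  show "\<pi> \<in> binary_types \<Gamma> \<Longrightarrow> finite \<pi>"
    using finite_max_consistent(2)[OF fin] by (simp add: binary_types_def)
qed


section \<open>NNF circuits\<close>

text \<open>
  A value of this type denotes the DAG whose nodes are its distinct subterms, with the value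
  itself as output node: equal subcircuits are one shared node.
\<close>

datatype 'a circuit =
    Top
  | Bot
  | Leaf "'a lit"
  | And_gate "'a circuit fset"
  | Or_gate "'a circuit fset"

text \<open>
  \<open>Abs_fset\<close> is meaningful on finite sets only; by the finiteness lemmas above, the compilation
  applies it to no others.
\<close>

definition mk_And :: "'a circuit set \<Rightarrow> 'a circuit" where
  "mk_And S = (if S = {} then Top else And_gate (Abs_fset S))"

definition mk_Or :: "'a circuit set \<Rightarrow> 'a circuit" where
  "mk_Or S = (if S = {} then Bot else Or_gate (Abs_fset S))"

definition mk_And_lits :: "'a lit set \<Rightarrow> 'a circuit" where
  "mk_And_lits L = mk_And (Leaf ` L)"

primrec lit_true :: "'a set \<Rightarrow> 'a lit \<Rightarrow> bool" where
  "lit_true \<nu> (Pos a) \<longleftrightarrow> a \<in> \<nu>"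
| "lit_true \<nu> (Neg a) \<longleftrightarrow> a \<notin> \<nu>"

text \<open>Assignments are represented by the set of variables they make true.\<close>

primrec ceval :: "'a set \<Rightarrow> 'a circuit \<Rightarrow> bool" where
  "ceval \<nu> Top \<longleftrightarrow> True"
| "ceval \<nu> Bot \<longleftrightarrow> False"
| "ceval \<nu> (Leaf l) \<longleftrightarrow> lit_true \<nu> l"
| "ceval \<nu> (And_gate S) \<longleftrightarrow> False |\<notin>| fimage (ceval \<nu>) S"
| "ceval \<nu> (Or_gate S) \<longleftrightarrow> True |\<in>| fimage (ceval \<nu>) S"

definition sat_assignments :: "'a set \<Rightarrow> 'a circuit \<Rightarrow> 'a set set" where
  "sat_assignments V C = {\<nu>. \<nu> \<subseteq> V \<and> ceval \<nu> C}"

definition circuits_equivalent :: "'a set \<Rightarrow> 'a circuit \<Rightarrow> 'a circuit \<Rightarrow> bool" where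
  "circuits_equivalent V C C' \<longleftrightarrow> sat_assignments V C = sat_assignments V C'"


section \<open>Two-stage compilation\<close>

text \<open>
  The domain is \<open>e ` {1..n}\<close>.  A context is the conjunction of the literals in a set of ground
  literals, so that \<open>\<theta> \<union> inst_lits a a \<tau>\<close> is the context \<open>\<theta> \<and> \<tau>(a)\<close>, and the empty set is \<open>\<top>\<close>.
\<close>

definition extendable ::
  "('u, 'b) scott \<Rightarrow> (nat \<Rightarrow> 'e) \<Rightarrow> nat \<Rightarrow> ('u, 'b, 'e) atom lit set \<Rightarrow> bool" where
  "extendable \<Gamma> e n \<theta> \<longleftrightarrow> (\<exists>A :: ('u, 'b, 'e) struct.
     is_struct A \<and> universe A = e ` {1..n} \<and> models A \<Gamma> \<and> (\<forall>l\<in>\<theta>. holds_lit A id l))"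

definition assigned_type ::
  "('u, 'b) scott \<Rightarrow> ('u, 'b, 'e) atom lit set \<Rightarrow> 'e \<Rightarrow> ('u, 'b, var) atom lit set" where
  "assigned_type \<Gamma> \<theta> a = (THE \<tau>. \<tau> \<in> unary_types \<Gamma> \<and> inst_lits a a \<tau> \<subseteq> \<theta>)"

text \<open>
  The compilation reaches \<open>stage2\<close> only with \<open>i \<le> n\<close> and \<open>stage1\<close> only with \<open>i \<le> n + 1\<close>, so the
  tests below are the termination tests \<open>i = n\<close> and \<open>i = n + 1\<close>.
\<close>

function stage2 ::
  "('u, 'b) scott \<Rightarrow> (nat \<Rightarrow> 'e) \<Rightarrow> nat \<Rightarrow> nat \<Rightarrow> nat \<Rightarrow>
   ('u, 'b, 'e) atom lit set \<Rightarrow> ('u, 'b, 'e) atom circuit" where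
  "stage2 \<Gamma> e n i j \<theta> =
     (if i \<ge> n then Top
      else mk_Or
        ((\<lambda>\<pi>. mk_And {mk_And_lits (inst_lits (e i) (e j) \<pi>),
                       if j < n then stage2 \<Gamma> e n i (j + 1) (\<theta> \<union> inst_lits (e i) (e j) \<pi>)
                       else stage2 \<Gamma> e n (i + 1) (i + 2) (\<theta> \<union> inst_lits (e i) (e j) \<pi>)})
         ` {\<pi> \<in> compatible \<Gamma> (assigned_type \<Gamma> \<theta> (e i)) (assigned_type \<Gamma> \<theta> (e j)).
              extendable \<Gamma> e n (\<theta> \<union> inst_lits (e i) (e j) \<pi>)}))"
  by pat_completeness auto
termination
  by (relation "measures [\<lambda>(\<Gamma>, e, n, i, j, \<theta>). n - i, \<lambda>(\<Gamma>, e, n, i, j, \<theta>). n - j]") auto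

function stage1 ::
  "('u, 'b) scott \<Rightarrow> (nat \<Rightarrow> 'e) \<Rightarrow> nat \<Rightarrow> nat \<Rightarrow>
   ('u, 'b, 'e) atom lit set \<Rightarrow> ('u, 'b, 'e) atom circuit" where
  "stage1 \<Gamma> e n i \<theta> =
     (if i \<ge> n + 1 then stage2 \<Gamma> e n 1 2 \<theta>
      else mk_Or
        ((\<lambda>\<tau>. mk_And {mk_And_lits (inst_lits (e i) (e i) \<tau>),
                       stage1 \<Gamma> e n (i + 1) (\<theta> \<union> inst_lits (e i) (e i) \<tau>)})
         ` {\<tau> \<in> valid_types \<Gamma>. extendable \<Gamma> e n (\<theta> \<union> inst_lits (e i) (e i) \<tau>)}))"
  by pat_completeness auto
termination
  by (relation "measure (\<lambda>(\<Gamma>, e, n, i, \<theta>). n + 1 - i)") auto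

declare stage1.simps [simp del] stage2.simps [simp del]

text \<open>
  \<open>stage1_call \<Gamma> e n i \<theta>\<close>: the compilation, started as \<open>stage1 \<Gamma> e n 1 {}\<close>, makes the call
  \<open>stage1 \<Gamma> e n i \<theta>\<close>.
\<close>

inductive stage1_call ::
  "('u, 'b) scott \<Rightarrow> (nat \<Rightarrow> 'e) \<Rightarrow> nat \<Rightarrow> nat \<Rightarrow> ('u, 'b, 'e) atom lit set \<Rightarrow> bool"
  for \<Gamma> e n where
  initial: "stage1_call \<Gamma> e n 1 {}"
| step: "\<lbrakk>stage1_call \<Gamma> e n i \<theta>; i \<le> n; \<tau> \<in> valid_types \<Gamma>;
     extendable \<Gamma> e n (\<theta> \<union> inst_lits (e i) (e i) \<tau>)\<rbrakk>
   \<Longrightarrow> stage1_call \<Gamma> e n (i + 1) (\<theta> \<union> inst_lits (e i) (e i) \<tau>)"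

end

theory Submission
  imports Defs
begin

text \<open>
  Replacing the unary type \<open>\<tau>\<close> of one element of a model by \<open>\<tau>'\<close>, while keeping all other atoms,
  preserves \<open>\<Gamma>\<close>: validity of \<open>\<tau>'\<close> handles the diagonal instance of the matrix, equality of the sets
  of compatible binary types handles the other instances, and agreement on the atoms
  \<open>\<beta>\<^sub>k(x,x)\<close> preserves all existential witnesses.  So \<open>Extendable\<close> cannot distinguish the two
  contexts, the two runs of the compilation make the same choices throughout, and the circuits they
  return are not only equivalent but equal.
\<close>

section \<open>Literals, instances and entailment\<close>

lemma lits_over_iff [simp]:
  "Pos x \<in> lits_over As \<longleftrightarrow> x \<in> As" "Neg x \<in> lits_over As \<longleftrightarrow> x \<in> As"
  by (auto simp: lits_over_def)

text \<open>An undecided atom could be added positively, against maximality. Conversely, enlarging a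
  set that decides every atom can only create a complementary pair.\<close>

lemma max_consistent_iff:
  "max_consistent As L \<longleftrightarrow> L \<subseteq> lits_over As \<and> (\<forall>a\<in>As. (Pos a \<in> L) \<noteq> (Neg a \<in> L))"
proof
  assume max: "max_consistent As L"
  then have L: "L \<subseteq> lits_over As" "consistent L"
    by (auto simp: max_consistent_def)
  have "Pos a \<in> L \<or> Neg a \<in> L" if "a \<in> As" for a
  proof (rule ccontr)
    assume neither: "\<not> (Pos a \<in> L \<or> Neg a \<in> L)"
    then have "consistent (insert (Pos a) L)" "insert (Pos a) L \<subseteq> lits_over As"
      using L that by (auto simp: consistent_def lits_over_def)
    then have "insert (Pos a) L = L"
      using max unfolding max_consistent_def by blast
    then show False using neither by blast
  qed
  then show "L \<subseteq> lits_over As \<and> (\<forall>a\<in>As. (Pos a \<in> L) \<noteq> (Neg a \<in> L))"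
    using L by (auto simp: consistent_def)
next
  assume L: "L \<subseteq> lits_over As \<and> (\<forall>a\<in>As. (Pos a \<in> L) \<noteq> (Neg a \<in> L))"
  then have "consistent L"
    by (auto simp: consistent_def lits_over_def)
  moreover have "L' \<subseteq> L" if "L \<subseteq> L'" "L' \<subseteq> lits_over As" "consistent L'" for L'
    using L that unfolding consistent_def lits_over_def by fast
  ultimately show "max_consistent As L"
    using L unfolding max_consistent_def by blast
qed

lemma max_consistent_subset_eq:
  assumes "max_consistent As L" "max_consistent As L'" "L \<subseteq> L'"
  shows "L = L'"
  using assms unfolding max_consistent_def by blast

lemma holds_atom_map [simp]: "holds_atom A s (map_atom id id g x) = holds_atom A (s \<circ> g) x"
  by (cases x) auto

lemma holds_lit_map [simp]:
  "holds_lit A s (map_lit (inst_atom p q) l) = holds_lit A (s \<circ> sub p q) l"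
  by (cases l) (auto simp: inst_atom_def)

lemma holds_inst_qf [simp]: "holds A s (inst_qf p q f) = holds A (s \<circ> sub p q) f"
  by (induction f) (auto simp: inst_qf_def comp_def)

lemma comp_sub [simp]: "s \<circ> sub p q = sub (s p) (s q)"
  by (auto simp: sub_def fun_eq_iff split: var.splits)

lemma sub_simps [simp]: "sub p q X = p" "sub p q Y = q"
  by (simp_all add: sub_def)

lemma sub_same: "sub p p = (\<lambda>_. p)"
  by (auto simp: sub_def fun_eq_iff split: var.splits)

lemma sub_eta [simp]: "sub (s X) (s Y) = s"
  by (auto simp: sub_def fun_eq_iff split: var.splits)

lemma inst_lits_holds:
  "(\<forall>l\<in>inst_lits p q L. holds_lit A s l) \<longleftrightarrow> (\<forall>l\<in>L. holds_lit A (sub (s p) (s q)) l)"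
  by (auto simp: inst_lits_def)

lemma holds_cong:
  assumes "\<And>P v. P \<in> upreds f \<Longrightarrow> holds_atom A s (Unary P v) = holds_atom B s' (Unary P v)"
    and "\<And>R v w. R \<in> bpreds f \<Longrightarrow> holds_atom A s (Binary R v w) = holds_atom B s' (Binary R v w)"
  shows "holds A s f = holds B s' f"
  using assms
proof (induction f)
  case (Atom a)
  then show ?case by (cases a) auto
qed auto

text \<open>\<open>entails\<close> ranges over structures on the natural numbers. Pulling a
  structure back to two points that stand for \<open>x\<close> and \<open>y\<close> carries an
  entailment over to an arbitrary universe.\<close>

lemma holds_entailed:
  assumes "entails L f" and lits: "\<forall>l\<in>L. holds_lit A s l"
  shows "holds A s f"
proof -
  \<comment> \<open>The points 0 and 1 stay distinct even if \<open>s X = s Y\<close>; two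
    indistinguishable points are harmless in a logic without equality.\<close>
  define g where "g k = (if k = 0 then s X else s Y)" for k :: nat
  define B :: "('a, 'b, nat) struct" where
    "B = \<lparr>universe = {0, 1}, uinterp = (\<lambda>P. {k \<in> {0, 1}. g k \<in> uinterp A P}),
      binterp = (\<lambda>R. {(k, l) \<in> {0, 1} \<times> {0, 1}. (g k, g l) \<in> binterp A R})\<rparr>"
  have B: "holds_atom B (sub 0 1) x = holds_atom A s x" for x
    by (cases x) (auto simp: B_def g_def sub_def split: var.splits)
  have "holds_lit B (sub 0 1) l = holds_lit A s l" for l
    by (cases l) (simp_all only: holds_lit.simps B)
  moreover have "is_struct B" "\<forall>v. sub 0 1 v \<in> universe B"
    by (auto simp: B_def is_struct_def sub_def split: var.splits)
  ultimately have "holds B (sub 0 1) f"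
    using assms by (auto simp: entails_def)
  moreover have "holds B (sub 0 1) f = holds A s f"
    by (rule holds_cong) (simp_all only: B)
  ultimately show ?thesis by simp
qed

section \<open>Types realised in a structure\<close>

definition unary_atoms :: "('u, 'b) scott \<Rightarrow> ('u, 'b, var) atom set" where
  "unary_atoms \<Gamma> =
     {Unary P X | P. P \<in> unary_preds \<Gamma>} \<union> {Binary R X X | R. R \<in> binary_preds \<Gamma>}"

definition binary_atoms :: "('u, 'b) scott \<Rightarrow> ('u, 'b, var) atom set" where
  "binary_atoms \<Gamma> =
     {Binary R X Y | R. R \<in> binary_preds \<Gamma>} \<union> {Binary R Y X | R. R \<in> binary_preds \<Gamma>}"

definition true_lits ::
  "('u, 'b, var) atom set \<Rightarrow> ('u, 'b, 'd) struct \<Rightarrow> (var \<Rightarrow> 'd) \<Rightarrow> ('u, 'b, var) atom lit set"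
  where "true_lits As A s = {l \<in> lits_over As. holds_lit A s l}"

lemma unary_types_iff: "\<tau> \<in> unary_types \<Gamma> \<longleftrightarrow> max_consistent (unary_atoms \<Gamma>) \<tau>"
  by (simp add: unary_types_def unary_atoms_def)

lemma binary_types_iff: "\<pi> \<in> binary_types \<Gamma> \<longleftrightarrow> max_consistent (binary_atoms \<Gamma>) \<pi>"
  by (simp add: binary_types_def binary_atoms_def)

lemma unary_type_lits: "\<tau> \<in> unary_types \<Gamma> \<Longrightarrow> \<tau> \<subseteq> lits_over (unary_atoms \<Gamma>)"
  by (simp add: unary_types_iff max_consistent_iff)

lemma binary_type_lits: "\<pi> \<in> binary_types \<Gamma> \<Longrightarrow> \<pi> \<subseteq> lits_over (binary_atoms \<Gamma>)"
  by (simp add: binary_types_iff max_consistent_iff)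

lemma valid_types_unary: "\<tau> \<in> valid_types \<Gamma> \<Longrightarrow> \<tau> \<in> unary_types \<Gamma>"
  by (simp add: valid_types_def)

lemma max_consistent_true_lits: "max_consistent As (true_lits As A s)"
  by (auto simp: max_consistent_iff true_lits_def lits_over_def)

lemma eq_true_lits:
  assumes "max_consistent As L" "\<forall>l\<in>L. holds_lit A s l"
  shows "L = true_lits As A s"
proof (rule max_consistent_subset_eq[OF assms(1) max_consistent_true_lits])
  show "L \<subseteq> true_lits As A s"
    using assms by (auto simp: true_lits_def max_consistent_iff)
qed

lemma type_decides_atom:
  assumes "max_consistent As L" "x \<in> As"
    and "\<forall>l\<in>L. holds_lit A s l" "\<forall>l\<in>L. holds_lit B s' l"
  shows "holds_atom A s x = holds_atom B s' x"
proof (cases "Pos x \<in> L")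
  case False
  then have "Neg x \<in> L" using assms by (auto simp: max_consistent_iff)
  then show ?thesis using assms(3,4) by fastforce
qed (use assms(3,4) in fastforce)

lemma unary_lit_holds_cong:
  assumes "\<tau> \<in> unary_types \<Gamma>" "l \<in> \<tau>" "s X = s' X"
  shows "holds_lit A s l = holds_lit A s' l"
  using subsetD[OF unary_type_lits[OF assms(1)] assms(2)] assms(3)
  by (auto simp: lits_over_def unary_atoms_def)

text \<open>With both variables at one element, every atom becomes an instance of an atom decided by
  the type.\<close>

lemma unary_type_determines:
  assumes \<tau>: "\<tau> \<in> unary_types \<Gamma>"
    and A: "\<forall>l\<in>\<tau>. holds_lit A s l" and B: "\<forall>l\<in>\<tau>. holds_lit B s' l"
    and preds: "upreds f \<subseteq> unary_preds \<Gamma>" "bpreds f \<subseteq> binary_preds \<Gamma>"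
  shows "holds A (sub (s X) (s X)) f = holds B (sub (s' X) (s' X)) f"
proof -
  note decide = type_decides_atom[OF \<tau>[unfolded unary_types_iff] _ A B]
  show ?thesis
  proof (rule holds_cong)
    fix P v assume "P \<in> upreds f"
    then show "holds_atom A (sub (s X) (s X)) (Unary P v) =
        holds_atom B (sub (s' X) (s' X)) (Unary P v)"
      using preds decide[of "Unary P X"] by (cases v) (auto simp: unary_atoms_def)
  next
    fix R v w assume "R \<in> bpreds f"
    then show "holds_atom A (sub (s X) (s X)) (Binary R v w) =
        holds_atom B (sub (s' X) (s' X)) (Binary R v w)"
      using preds decide[of "Binary R X X"] by (cases v; cases w) (auto simp: unary_atoms_def)
  qed
qed

text \<open>An atom in \<open>x\<close> alone is decided by \<open>\<tau>\<close>, one in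
  \<open>y\<close> alone by \<open>\<sigma>\<close>, and a mixed one by
  \<open>\<pi>\<close>.\<close>

lemma types_determine:
  assumes \<tau>: "\<tau> \<in> unary_types \<Gamma>" and \<sigma>: "\<sigma> \<in> unary_types \<Gamma>" and \<pi>: "\<pi> \<in> binary_types \<Gamma>"
    and A: "\<forall>l\<in>\<tau> \<union> inst_lits Y Y \<sigma> \<union> \<pi>. holds_lit A s l"
    and B: "\<forall>l\<in>\<tau> \<union> inst_lits Y Y \<sigma> \<union> \<pi>. holds_lit B s' l"
    and preds: "upreds f \<subseteq> unary_preds \<Gamma>" "bpreds f \<subseteq> binary_preds \<Gamma>"
  shows "holds A s f = holds B s' f"
proof -
  have \<sigma>_lits: "\<forall>l\<in>\<sigma>. holds_lit A (sub (s Y) (s Y)) l" "\<forall>l\<in>\<sigma>. holds_lit B (sub (s' Y) (s' Y)) l"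
    using A B by (simp_all add: ball_Un inst_lits_holds)
  have \<tau>_lits: "\<forall>l\<in>\<tau>. holds_lit A s l" "\<forall>l\<in>\<tau>. holds_lit B s' l"
    and \<pi>_lits: "\<forall>l\<in>\<pi>. holds_lit A s l" "\<forall>l\<in>\<pi>. holds_lit B s' l"
    using A B by (simp_all add: ball_Un)
  note \<tau>_dec = type_decides_atom[OF \<tau>[unfolded unary_types_iff] _ \<tau>_lits]
  note \<sigma>_dec = type_decides_atom[OF \<sigma>[unfolded unary_types_iff] _ \<sigma>_lits]
  note \<pi>_dec = type_decides_atom[OF \<pi>[unfolded binary_types_iff] _ \<pi>_lits]
  show ?thesis
  proof (rule holds_cong)
    fix P v assume "P \<in> upreds f"
    then show "holds_atom A s (Unary P v) = holds_atom B s' (Unary P v)"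
      using preds \<tau>_dec[of "Unary P X"] \<sigma>_dec[of "Unary P X"]
      by (cases v) (auto simp: unary_atoms_def)
  next
    fix R v w assume "R \<in> bpreds f"
    then have "R \<in> binary_preds \<Gamma>" using preds by blast
    then show "holds_atom A s (Binary R v w) = holds_atom B s' (Binary R v w)"
      using \<tau>_dec[of "Binary R X X"] \<sigma>_dec[of "Binary R X X"]
        \<pi>_dec[of "Binary R X Y"] \<pi>_dec[of "Binary R Y X"]
      by (cases v; cases w) (auto simp: unary_atoms_def binary_atoms_def)
  qed
qed

lemma matrix_preds: "upreds (matrix \<Gamma>) \<subseteq> unary_preds \<Gamma>" "bpreds (matrix \<Gamma>) \<subseteq> binary_preds \<Gamma>"
  by (auto simp: unary_preds_def binary_preds_def)

lemma compatible_binary_types: "\<pi> \<in> compatible \<Gamma> \<sigma> \<tau> \<Longrightarrow> \<pi> \<in> binary_types \<Gamma>"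
  by (simp add: compatible_def)

section \<open>The types realised by elements of a model\<close>

definition utype :: "('u, 'b) scott \<Rightarrow> ('u, 'b, 'd) struct \<Rightarrow> 'd \<Rightarrow> ('u, 'b, var) atom lit set" where
  "utype \<Gamma> A a = true_lits (unary_atoms \<Gamma>) A (sub a a)"

lemma utype_unary: "utype \<Gamma> A a \<in> unary_types \<Gamma>"
  by (simp add: utype_def unary_types_iff max_consistent_true_lits)

lemma utype_holds: "\<forall>l\<in>utype \<Gamma> A a. holds_lit A (sub a a) l"
  by (simp add: utype_def true_lits_def)

lemma eq_utype:
  assumes "\<sigma> \<in> unary_types \<Gamma>" "\<forall>l\<in>inst_lits a a \<sigma>. holds_lit A id l"
  shows "\<sigma> = utype \<Gamma> A a"
  using assms eq_true_lits[of "unary_atoms \<Gamma>" \<sigma> A "sub a a"]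
  by (simp add: utype_def inst_lits_holds unary_types_iff)

text \<open>Validity speaks of all structures, but the matrix holds at \<open>(a, a)\<close> in
  \<open>A\<close>, and the type of \<open>a\<close> fixes its truth value everywhere.\<close>

lemma utype_valid:
  assumes "models A \<Gamma>" "a \<in> universe A"
  shows "utype \<Gamma> A a \<in> valid_types \<Gamma>"
proof -
  have "holds B s (inst_qf X X (matrix \<Gamma>))" if "\<forall>l\<in>utype \<Gamma> A a. holds_lit B s l"
    for B :: "('a, 'b, nat) struct" and s
    using unary_type_determines[OF utype_unary that utype_holds matrix_preds] assms
    by (simp add: models_def)
  then show ?thesis
    by (auto simp: valid_types_def utype_unary entails_def)
qed

text \<open>The realised types decide both instances of the matrix, so their truth at this one pair
  already yields the entailment.\<close>

lemma true_binary_lits_compatible: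
  assumes mod: "models A \<Gamma>" and a: "a \<in> universe A" and b: "b \<in> universe A"
  shows "true_lits (binary_atoms \<Gamma>) A (sub a b) \<in> compatible \<Gamma> (utype \<Gamma> A a) (utype \<Gamma> A b)"
proof -
  let ?\<pi> = "true_lits (binary_atoms \<Gamma>) A (sub a b)"
  let ?f = "Conj (inst_qf X Y (matrix \<Gamma>)) (inst_qf Y X (matrix \<Gamma>))"
  have \<pi>: "?\<pi> \<in> binary_types \<Gamma>"
    by (simp add: binary_types_iff max_consistent_true_lits)
  \<comment> \<open>\<open>utype_holds\<close> puts both variables at \<open>a\<close>; moving
    \<open>y\<close> to \<open>b\<close> changes nothing, since literals of a unary type mention
    only \<open>x\<close>.\<close>
  have "\<forall>l\<in>utype \<Gamma> A a. holds_lit A (sub a b) l"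
    using utype_holds[of \<Gamma> A a] unary_lit_holds_cong[OF utype_unary, of _ \<Gamma> A a "sub a a" "sub a b"]
    by auto
  then have A: "\<forall>l\<in>utype \<Gamma> A a \<union> inst_lits Y Y (utype \<Gamma> A b) \<union> ?\<pi>. holds_lit A (sub a b) l"
    using utype_holds[of \<Gamma> A b] by (simp add: ball_Un inst_lits_holds) (simp add: true_lits_def)
  have preds: "upreds (inst_qf p q (matrix \<Gamma>)) \<subseteq> unary_preds \<Gamma>"
      "bpreds (inst_qf p q (matrix \<Gamma>)) \<subseteq> binary_preds \<Gamma>" for p q :: var
    using matrix_preds[of \<Gamma>] by (simp_all add: inst_qf_def qf.set_map)
  have "holds A (sub a b) ?f"
    using mod a b by (simp add: models_def)
  then have "holds B s ?f"
    if "\<forall>l\<in>utype \<Gamma> A a \<union> inst_lits Y Y (utype \<Gamma> A b) \<union> ?\<pi>. holds_lit B s l"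
    for B :: "('a, 'b, nat) struct" and s
    using types_determine[OF utype_unary utype_unary \<pi> A that, of ?f] preds by simp
  then show ?thesis
    using \<pi> by (simp add: compatible_def entails_def)
qed

section \<open>Symmetry of compatibility\<close>

lemma map_lit_swap_swap:
  "map_lit (inst_atom Y X) (map_lit (inst_atom Y X) l) = (l :: ('u, 'b, var) atom lit)"
proof -
  have "sub Y X \<circ> sub Y X = id"
    by (auto simp: sub_def fun_eq_iff split: var.splits)
  then show ?thesis
    by (cases l) (auto simp: inst_atom_def atom.map_comp atom.map_id simp del: comp_sub)
qed

lemma inst_lits_swap_swap: "inst_lits Y X (inst_lits Y X \<pi>) = \<pi>"
  by (simp add: inst_lits_def image_image map_lit_swap_swap)

text \<open>Exchanging the variables is a sign-preserving involution that permutes the binary atoms,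
  so each of them remains decided exactly once.\<close>

lemma binary_types_swap:
  assumes "\<pi> \<in> binary_types \<Gamma>"
  shows "inst_lits Y X \<pi> \<in> binary_types \<Gamma>"
proof -
  have "inj (map_lit (inst_atom Y X) :: ('a, 'b, var) atom lit \<Rightarrow> _)"
    by (rule inj_on_inverseI[of _ "map_lit (inst_atom Y X)"]) (rule map_lit_swap_swap)
  then have mem: "map_lit (inst_atom Y X) l \<in> inst_lits Y X \<pi> \<longleftrightarrow> l \<in> \<pi>" for l
    by (simp add: inst_lits_def inj_image_mem_iff)
  have swap: "inst_atom Y X x \<in> binary_atoms \<Gamma>" if "x \<in> binary_atoms \<Gamma>" for x
    using that by (auto simp: binary_atoms_def inst_atom_def)
  have "(Pos x \<in> inst_lits Y X \<pi>) \<noteq> (Neg x \<in> inst_lits Y X \<pi>)" if "x \<in> binary_atoms \<Gamma>" for x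
  proof -
    let ?y = "inst_atom Y X x"
    have "inst_atom Y X ?y = x"
      using map_lit_swap_swap[of "Pos x"] by simp
    moreover have "(Pos ?y \<in> \<pi>) \<noteq> (Neg ?y \<in> \<pi>)"
      using assms swap[OF that] by (simp add: binary_types_iff max_consistent_iff)
    ultimately show ?thesis
      using mem[of "Pos ?y"] mem[of "Neg ?y"] by simp
  qed
  moreover have "map_lit (inst_atom Y X) l \<in> lits_over (binary_atoms \<Gamma>)"
    if "l \<in> lits_over (binary_atoms \<Gamma>)" for l
    using that swap by (cases l) simp_all
  then have "inst_lits Y X \<pi> \<subseteq> lits_over (binary_atoms \<Gamma>)"
    using binary_type_lits[OF assms] by (auto simp: inst_lits_def)
  ultimately show ?thesis
    by (simp add: binary_types_iff max_consistent_iff)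
qed

text \<open>The entailed conjunction is invariant under exchange of the variables. An assignment
  that satisfies the exchanged premises satisfies the original ones once its two values are
  exchanged.\<close>

lemma compatible_swap:
  assumes \<sigma>: "\<sigma> \<in> unary_types \<Gamma>" and \<tau>: "\<tau> \<in> unary_types \<Gamma>" and \<pi>: "\<pi> \<in> compatible \<Gamma> \<sigma> \<tau>"
  shows "inst_lits Y X \<pi> \<in> compatible \<Gamma> \<tau> \<sigma>"
proof -
  let ?f = "Conj (inst_qf X Y (matrix \<Gamma>)) (inst_qf Y X (matrix \<Gamma>))"
  have ent: "entails (\<sigma> \<union> inst_lits Y Y \<tau> \<union> \<pi>) ?f"
    using \<pi> by (simp add: compatible_def)
  have "holds B s ?f" if "\<forall>l\<in>\<tau> \<union> inst_lits Y Y \<sigma> \<union> inst_lits Y X \<pi>. holds_lit B s l"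
    for B :: "('a, 'b, nat) struct" and s
  proof -
    have lits: "\<forall>l\<in>\<tau>. holds_lit B s l" "\<forall>l\<in>\<sigma>. holds_lit B (sub (s Y) (s Y)) l"
      "\<forall>l\<in>\<pi>. holds_lit B (sub (s Y) (s X)) l"
      using that by (simp_all add: ball_Un inst_lits_holds)
    have "\<forall>l\<in>\<tau>. holds_lit B (sub (s X) (s X)) l"
      using lits(1) unary_lit_holds_cong[OF \<tau>, of _ s "sub (s X) (s X)"] by auto
    moreover have "\<forall>l\<in>\<sigma>. holds_lit B (sub (s Y) (s X)) l"
      using lits(2) unary_lit_holds_cong[OF \<sigma>, of _ "sub (s Y) (s Y)" "sub (s Y) (s X)"] by auto
    ultimately have "\<forall>l\<in>\<sigma> \<union> inst_lits Y Y \<tau> \<union> \<pi>. holds_lit B (sub (s Y) (s X)) l"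
      using lits(3) by (simp add: ball_Un inst_lits_holds)
    from holds_entailed[OF ent this] show ?thesis by simp
  qed
  then show ?thesis
    using \<pi> binary_types_swap by (auto simp: compatible_def entails_def)
qed

text \<open>The assumption on \<open>compatible\<close> concerns its first argument, whereas the
  retyped element may also be the second one of a pair in Stage-II.\<close>

lemma compatible_eq_swap:
  assumes \<sigma>: "\<sigma> \<in> unary_types \<Gamma>" and \<tau>: "\<tau> \<in> unary_types \<Gamma>" and \<tau>': "\<tau>' \<in> unary_types \<Gamma>"
    and eq: "compatible \<Gamma> \<tau> \<sigma> = compatible \<Gamma> \<tau>' \<sigma>"
  shows "compatible \<Gamma> \<sigma> \<tau> = compatible \<Gamma> \<sigma> \<tau>'"
proof -
  have "\<pi> \<in> compatible \<Gamma> \<sigma> \<tau>2"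
    if "\<tau>1 \<in> unary_types \<Gamma>" "\<tau>2 \<in> unary_types \<Gamma>" "compatible \<Gamma> \<tau>1 \<sigma> = compatible \<Gamma> \<tau>2 \<sigma>"
      "\<pi> \<in> compatible \<Gamma> \<sigma> \<tau>1" for \<pi> \<tau>1 \<tau>2
    using compatible_swap[OF that(2) \<sigma>, of "inst_lits Y X \<pi>"] compatible_swap[OF \<sigma> that(1,4)] that(3)
    by (simp add: inst_lits_swap_swap)
  then show ?thesis using \<tau> \<tau>' eq by blast
qed

section \<open>Exchanging the type of one element\<close>

text \<open>Bundled, the hypotheses on the two types form a symmetric relation, so that the
  implication \<open>extendable_exchange\<close> already gives an equivalence.\<close>

definition interchangeable ::
  "('u, 'b) scott \<Rightarrow> ('u, 'b, var) atom lit set \<Rightarrow> ('u, 'b, var) atom lit set \<Rightarrow> bool" where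
  "interchangeable \<Gamma> \<tau> \<tau>' \<longleftrightarrow> \<tau> \<in> valid_types \<Gamma> \<and> \<tau>' \<in> valid_types \<Gamma> \<and>
     (\<forall>k\<in>{1..num_ex \<Gamma>}. Pos (inst_atom X X (beta \<Gamma> k)) \<in> \<tau> \<longleftrightarrow> Pos (inst_atom X X (beta \<Gamma> k)) \<in> \<tau>') \<and>
     (\<forall>\<sigma>\<in>valid_types \<Gamma>. compatible \<Gamma> \<tau> \<sigma> = compatible \<Gamma> \<tau>' \<sigma>)"

lemma interchangeable_sym: "interchangeable \<Gamma> \<tau> \<tau>' \<Longrightarrow> interchangeable \<Gamma> \<tau>' \<tau>"
  by (auto simp: interchangeable_def)

text \<open>Atoms between \<open>a\<close> and another element are left alone, so all binary types
  realised by distinct elements survive.\<close>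

definition retype ::
  "'d \<Rightarrow> ('u, 'b, var) atom lit set \<Rightarrow> ('u, 'b, 'd) struct \<Rightarrow> ('u, 'b, 'd) struct" where
  "retype a \<tau> A = \<lparr>universe = universe A,
     uinterp = (\<lambda>P. uinterp A P - {a} \<union> (if Pos (Unary P X) \<in> \<tau> then {a} else {})),
     binterp = (\<lambda>R. binterp A R - {(a, a)} \<union> (if Pos (Binary R X X) \<in> \<tau> then {(a, a)} else {}))\<rparr>"

lemma universe_retype [simp]: "universe (retype a \<tau> A) = universe A"
  by (simp add: retype_def)

lemma is_struct_retype: "is_struct A \<Longrightarrow> a \<in> universe A \<Longrightarrow> is_struct (retype a \<tau> A)"
  by (auto simp: is_struct_def retype_def split: if_splits)

text \<open>The image of the terms is \<open>{a}\<close> exactly when the instance is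
  \<open>P(a)\<close> or \<open>R(a,a)\<close>. This covers ground atoms (\<open>s = id\<close>) and
  atoms with variables alike.\<close>

lemma holds_atom_retype:
  "s ` terms_atom x \<noteq> {a} \<Longrightarrow> holds_atom (retype a \<tau> A) s x = holds_atom A s x"
  by (cases x) (auto simp: retype_def)

lemma holds_lit_retype:
  "\<forall>x\<in>set_lit l. s ` terms_atom x \<noteq> {a} \<Longrightarrow> holds_lit (retype a \<tau> A) s l = holds_lit A s l"
  by (cases l) (auto simp: holds_atom_retype)

lemma holds_atom_retype_diag:
  assumes "s ` terms_atom x = {a}"
  shows "holds_atom (retype a \<tau> A) s x \<longleftrightarrow> Pos (inst_atom X X x) \<in> \<tau>"
  using assms by (cases x) (auto simp: retype_def inst_atom_def sub_same)

lemma retype_holds: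
  assumes "\<tau> \<in> unary_types \<Gamma>"
  shows "\<forall>l\<in>\<tau>. holds_lit (retype a \<tau> A) (sub a b) l"
proof
  fix l assume l: "l \<in> \<tau>"
  with assms have "l \<in> lits_over (unary_atoms \<Gamma>)"
    using unary_type_lits by blast
  then show "holds_lit (retype a \<tau> A) (sub a b) l"
    using l assms
    by (auto simp: lits_over_def unary_atoms_def retype_def unary_types_iff max_consistent_iff)
qed

lemma models_retype:
  assumes inter: "interchangeable \<Gamma> (utype \<Gamma> A a) \<tau>'"
    and mod: "models A \<Gamma>" and a: "a \<in> universe A"
  shows "models (retype a \<tau>' A) \<Gamma>"
proof -
  let ?A = "retype a \<tau>' A"
  have \<tau>': "\<tau>' \<in> unary_types \<Gamma>" and valid: "entails \<tau>' (inst_qf X X (matrix \<Gamma>))"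
    using inter by (auto simp: interchangeable_def valid_types_def)
  have diag: "holds ?A (sub a a) (matrix \<Gamma>)"
    using holds_entailed[OF valid retype_holds[OF \<tau>', of a A a]] by simp
  have off: "holds ?A (sub a b) (matrix \<Gamma>) \<and> holds ?A (sub b a) (matrix \<Gamma>)"
    if b: "b \<in> universe A" "b \<noteq> a" for b
  proof -
    let ?\<pi> = "true_lits (binary_atoms \<Gamma>) A (sub a b)"
    \<comment> \<open>The binary type realised by \<open>(a, b)\<close> is compatible with the old
      type of \<open>a\<close>; as the type of \<open>b\<close> is valid, interchangeability passes
      this on to \<open>\<tau>'\<close>.\<close>
    have "?\<pi> \<in> compatible \<Gamma> \<tau>' (utype \<Gamma> A b)"
      using true_binary_lits_compatible[OF mod a b(1)] inter utype_valid[OF mod b(1)]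
      by (auto simp: interchangeable_def)
    then have ent: "entails (\<tau>' \<union> inst_lits Y Y (utype \<Gamma> A b) \<union> ?\<pi>)
        (Conj (inst_qf X Y (matrix \<Gamma>)) (inst_qf Y X (matrix \<Gamma>)))"
      by (simp add: compatible_def)
    have "holds_lit ?A (sub b b) l" if "l \<in> utype \<Gamma> A b" for l
    proof -
      have "holds_lit ?A (sub b b) l = holds_lit A (sub b b) l"
        using that b
        by (intro holds_lit_retype)
          (auto simp: utype_def true_lits_def lits_over_def unary_atoms_def)
      then show ?thesis using that utype_holds[of \<Gamma> A b] by simp
    qed
    moreover have "holds_lit ?A (sub a b) l" if "l \<in> ?\<pi>" for l
    proof -
      have "holds_lit ?A (sub a b) l = holds_lit A (sub a b) l"
        using that b
        by (intro holds_lit_retype)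
          (auto simp: true_lits_def lits_over_def binary_atoms_def)
      then show ?thesis using that by (simp add: true_lits_def)
    qed
    ultimately have "\<forall>l\<in>\<tau>' \<union> inst_lits Y Y (utype \<Gamma> A b) \<union> ?\<pi>. holds_lit ?A (sub a b) l"
      using retype_holds[OF \<tau>', of a A b] by (simp add: ball_Un inst_lits_holds)
    from holds_entailed[OF ent this] show ?thesis by simp
  qed
  have "holds ?A (sub b c) (matrix \<Gamma>)" if "b \<in> universe A" "c \<in> universe A" for b c
  proof (cases "b = a \<or> c = a")
    case False
    have "a \<notin> range (sub b c)"
      using False by (auto simp: sub_def split: var.splits)
    then have "sub b c ` S \<noteq> {a}" for S
      by blast
    then have "holds ?A (sub b c) (matrix \<Gamma>) = holds A (sub b c) (matrix \<Gamma>)"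
      by (intro holds_cong holds_atom_retype)
    then show ?thesis using mod that by (simp add: models_def)
  qed (use diag off that in auto)
  moreover have "\<exists>c\<in>universe A. holds_atom ?A (sub b c) (beta \<Gamma> k)"
    if k: "k \<in> {1..num_ex \<Gamma>}" and b: "b \<in> universe A" for k b
  proof -
    obtain c where c: "c \<in> universe A" "holds_atom A (sub b c) (beta \<Gamma> k)"
      using mod k b unfolding models_def by blast
    have "holds_atom ?A (sub b c) (beta \<Gamma> k)"
    \<comment> \<open>The old witness \<open>c\<close> is kept. The instance may be
      \<open>R(a,a)\<close> even if \<open>b\<close> and \<open>c\<close> differ, since the atom can
      be \<open>R(x,x)\<close> or \<open>R(y,y)\<close>; in every such case its truth is read off
      the type of \<open>a\<close>.\<close>
    proof (cases "sub b c ` terms_atom (beta \<Gamma> k) = {a}")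
      case True
      have "inst_atom X X (beta \<Gamma> k) \<in> unary_atoms \<Gamma>"
        using k by (cases "beta \<Gamma> k")
          (force simp: unary_atoms_def unary_preds_def binary_preds_def inst_atom_def sub_def
            split: var.splits)+
      moreover have "holds_atom A (sub a a) (inst_atom X X (beta \<Gamma> k))"
        using c(2) True by (cases "beta \<Gamma> k") (auto simp: inst_atom_def sub_same)
      ultimately have "Pos (inst_atom X X (beta \<Gamma> k)) \<in> utype \<Gamma> A a"
        by (simp add: utype_def true_lits_def lits_over_def)
      then show ?thesis
        using inter k True by (auto simp: interchangeable_def holds_atom_retype_diag)
    qed (use c(2) in \<open>simp add: holds_atom_retype\<close>)
    then show ?thesis using c(1) by blast
  qed
  ultimately show ?thesis by (simp add: models_def)
qed

text \<open>The frame condition: this part of a context keeps its truth when \<open>a\<close> is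
  retyped.\<close>

definition diag_free :: "'e \<Rightarrow> ('u, 'b, 'e) atom lit set \<Rightarrow> bool" where
  "diag_free a M \<longleftrightarrow> (\<forall>l\<in>M. \<forall>x\<in>set_lit l. terms_atom x \<noteq> {a})"

lemma diag_free_Un: "diag_free a (M \<union> N) \<longleftrightarrow> diag_free a M \<and> diag_free a N"
  by (auto simp: diag_free_def)

lemma unary_inst_terms:
  assumes "\<sigma> \<in> unary_types \<Gamma>" "l \<in> inst_lits b b \<sigma>" "x \<in> set_lit l"
  shows "terms_atom x = {b}"
proof -
  obtain l' where "l' \<in> lits_over (unary_atoms \<Gamma>)" "l = map_lit (inst_atom b b) l'"
    using assms(2) unary_type_lits[OF assms(1)] by (auto simp: inst_lits_def)
  then show ?thesis
    using assms(3) by (auto simp: lits_over_def unary_atoms_def inst_atom_def)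
qed

lemma diag_free_unary: "\<sigma> \<in> unary_types \<Gamma> \<Longrightarrow> b \<noteq> a \<Longrightarrow> diag_free a (inst_lits b b \<sigma>)"
  using unary_inst_terms by (fastforce simp: diag_free_def)

lemma diag_free_binary:
  assumes "\<pi> \<in> binary_types \<Gamma>" "b \<noteq> c"
  shows "diag_free a (inst_lits b c \<pi>)"
proof -
  have "terms_atom x \<noteq> {a}"
    if "l \<in> lits_over (binary_atoms \<Gamma>)" "x \<in> set_lit (map_lit (inst_atom b c) l)" for l x
    using that assms(2) by (auto simp: lits_over_def binary_atoms_def inst_atom_def)
  then show ?thesis
    using binary_type_lits[OF assms(1)] by (fastforce simp: diag_free_def inst_lits_def)
qed

lemma extendable_exchange:
  assumes inter: "interchangeable \<Gamma> \<tau> \<tau>'" and M: "diag_free a M" and a: "a \<in> e ` {1..n}"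
    and ext: "extendable \<Gamma> e n (M \<union> inst_lits a a \<tau>)"
  shows "extendable \<Gamma> e n (M \<union> inst_lits a a \<tau>')"
proof -
  obtain A :: "('a, 'b, 'c) struct" where A: "is_struct A" "universe A = e ` {1..n}" "models A \<Gamma>"
    "\<forall>l\<in>M \<union> inst_lits a a \<tau>. holds_lit A id l"
    using ext by (auto simp: extendable_def)
  have \<tau>: "\<tau> \<in> unary_types \<Gamma>" "\<tau>' \<in> unary_types \<Gamma>"
    using inter by (auto simp: interchangeable_def valid_types_def)
  \<comment> \<open>The model satisfies \<open>\<tau>\<close> at \<open>a\<close>, so maximality
    identifies \<open>\<tau>\<close> with the type realised there, to which
    \<open>models_retype\<close> refers.\<close>
  have "\<tau> = utype \<Gamma> A a"
    by (rule eq_utype[OF \<tau>(1)]) (use A(4) in simp)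
  then have "models (retype a \<tau>' A) \<Gamma>"
    using inter A(2,3) a by (intro models_retype) simp_all
  moreover have "holds_lit (retype a \<tau>' A) id l" if "l \<in> M" for l
  proof -
    have "holds_lit (retype a \<tau>' A) id l = holds_lit A id l"
      using M that by (intro holds_lit_retype) (auto simp: diag_free_def)
    then show ?thesis using A(4) that by blast
  qed
  moreover have "\<forall>l\<in>inst_lits a a \<tau>'. holds_lit (retype a \<tau>' A) id l"
    using retype_holds[OF \<tau>(2)] by (simp add: inst_lits_holds)
  ultimately show ?thesis
    using A(1,2) a is_struct_retype[of A a \<tau>'] unfolding extendable_def
    by (intro exI[of _ "retype a \<tau>' A"]) auto
qed

lemma extendable_exchange_iff:
  assumes "interchangeable \<Gamma> \<tau> \<tau>'" "diag_free a M" "a \<in> e ` {1..n}"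
  shows "extendable \<Gamma> e n (M \<union> inst_lits a a \<tau>) \<longleftrightarrow> extendable \<Gamma> e n (M \<union> inst_lits a a \<tau>')"
  using assms extendable_exchange interchangeable_sym by metis

section \<open>Equality of the two runs\<close>

lemma inst_lits_same_subset_iff:
  assumes "\<sigma> \<in> unary_types \<Gamma>" "\<tau> \<in> unary_types \<Gamma>"
  shows "inst_lits a a \<sigma> \<subseteq> inst_lits a a \<tau> \<longleftrightarrow> \<sigma> \<subseteq> \<tau>"
proof -
  \<comment> \<open>Substituting \<open>a\<close> for both variables identifies
    \<open>R(x,y)\<close> with \<open>R(x,x)\<close> in general, but literals of unary types contain
    only \<open>x\<close>.\<close>
  have "inj_on (map_lit (inst_atom a a)) (lits_over (unary_atoms \<Gamma>))"
    by (auto simp: inj_on_def lits_over_def unary_atoms_def inst_atom_def)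
  moreover have "\<sigma> \<subseteq> lits_over (unary_atoms \<Gamma>)" "\<tau> \<subseteq> lits_over (unary_atoms \<Gamma>)"
    using assms unary_type_lits by blast+
  ultimately show ?thesis
    unfolding inst_lits_def image_subset_iff
    using inj_on_image_mem_iff[of "map_lit (inst_atom a a)" "lits_over (unary_atoms \<Gamma>)" _ \<tau>]
    by blast
qed

lemma set_lit_nonempty: "set_lit l \<noteq> {}"
  by (cases l) auto

lemma assigned_type_same:
  assumes \<tau>: "\<tau> \<in> unary_types \<Gamma>" and M: "diag_free a M"
  shows "assigned_type \<Gamma> (M \<union> inst_lits a a \<tau>) a = \<tau>"
proof -
  have "\<sigma> = \<tau>" if \<sigma>: "\<sigma> \<in> unary_types \<Gamma>" and sub: "inst_lits a a \<sigma> \<subseteq> M \<union> inst_lits a a \<tau>" for \<sigma>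
  proof -
    have "l \<notin> M" if "l \<in> inst_lits a a \<sigma>" for l
      using M unary_inst_terms[OF \<sigma> that] set_lit_nonempty[of l] by (auto simp: diag_free_def)
    then have "\<sigma> \<subseteq> \<tau>"
      using sub inst_lits_same_subset_iff[OF \<sigma> \<tau>, of a] by blast
    then show ?thesis
      using \<sigma> \<tau> max_consistent_subset_eq by (auto simp: unary_types_iff)
  qed
  then show ?thesis
    using \<tau> unfolding assigned_type_def by (intro the_equality) auto
qed

text \<open>Type literals of different elements never coincide. The two definite descriptions thus
  have the same predicate and agree even where no unique solution is known.\<close>

lemma assigned_type_other:
  assumes \<tau>: "\<tau> \<in> unary_types \<Gamma>" and b: "b \<noteq> a"
  shows "assigned_type \<Gamma> (M \<union> inst_lits a a \<tau>) b = assigned_type \<Gamma> M b"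
proof -
  have "inst_lits b b \<sigma> \<subseteq> M \<union> inst_lits a a \<tau> \<longleftrightarrow> inst_lits b b \<sigma> \<subseteq> M"
    if \<sigma>: "\<sigma> \<in> unary_types \<Gamma>" for \<sigma>
  proof -
    have "l \<notin> inst_lits a a \<tau>" if "l \<in> inst_lits b b \<sigma>" for l
    proof
      obtain x where "x \<in> set_lit l"
        using set_lit_nonempty[of l] by blast
      moreover assume "l \<in> inst_lits a a \<tau>"
      ultimately show False
        using unary_inst_terms[OF \<sigma> that] unary_inst_terms[OF \<tau>, of l a] b by simp
    qed
    then show ?thesis by blast
  qed
  then have "(\<lambda>\<sigma>. \<sigma> \<in> unary_types \<Gamma> \<and> inst_lits b b \<sigma> \<subseteq> M \<union> inst_lits a a \<tau>) =
      (\<lambda>\<sigma>. \<sigma> \<in> unary_types \<Gamma> \<and> inst_lits b b \<sigma> \<subseteq> M)"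
    by (intro ext conj_cong refl)
  then show ?thesis by (simp add: assigned_type_def)
qed

text \<open>The existence half of the definite description in \<open>assigned_type\<close>;
  \<open>assigned_type_valid\<close> obtains uniqueness from a model.\<close>

definition has_type ::
  "('u, 'b) scott \<Rightarrow> ('u, 'b, 'e) atom lit set \<Rightarrow> 'e \<Rightarrow> bool" where
  "has_type \<Gamma> M b \<longleftrightarrow> (\<exists>\<sigma>\<in>unary_types \<Gamma>. inst_lits b b \<sigma> \<subseteq> M)"

lemma has_type_mono: "has_type \<Gamma> M b \<Longrightarrow> has_type \<Gamma> (M \<union> N) b"
  by (auto simp: has_type_def)

text \<open>In a model of \<open>N\<close>, every type of \<open>b\<close> contained in
  \<open>M\<close> is the realised one, which gives uniqueness and validity at once. Validity
  matters because \<open>interchangeable\<close> compares compatible sets against valid types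
  only.\<close>

lemma assigned_type_valid:
  assumes ext: "extendable \<Gamma> e n N" and sub: "M \<subseteq> N" and ty: "has_type \<Gamma> M b" and b: "b \<in> e ` {1..n}"
  shows "assigned_type \<Gamma> M b \<in> valid_types \<Gamma>"
proof -
  obtain A :: "('a, 'b, 'c) struct" where A: "universe A = e ` {1..n}" "models A \<Gamma>"
    "\<forall>l\<in>N. holds_lit A id l"
    using ext by (auto simp: extendable_def)
  have eq: "\<sigma> = utype \<Gamma> A b" if "\<sigma> \<in> unary_types \<Gamma>" "inst_lits b b \<sigma> \<subseteq> M" for \<sigma>
    by (rule eq_utype[OF that(1)]) (use subset_trans[OF that(2) sub] A(3) in \<open>simp add: subset_iff\<close>)
  moreover obtain \<sigma> where "\<sigma> \<in> unary_types \<Gamma>" "inst_lits b b \<sigma> \<subseteq> M"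
    using ty by (auto simp: has_type_def)
  ultimately have "assigned_type \<Gamma> M b = utype \<Gamma> A b"
    unfolding assigned_type_def by (intro the_equality) auto
  then show ?thesis using utype_valid[of A \<Gamma> b] A(1,2) b by simp
qed

text \<open>Both contexts are a common frame \<open>M\<close> plus a type of \<open>e p\<close>, and
  the frame absorbs each chosen binary type. The bound on \<open>j\<close> is conditional because
  the terminating call is at \<open>(n, n + 1)\<close>.\<close>

lemma stage2_exchange:
  assumes inter: "interchangeable \<Gamma> \<tau> \<tau>'" and inj: "inj_on e {1..n}" and p: "p \<in> {1..n}"
    and "diag_free (e p) M" "\<And>j. j \<in> {1..n} - {p} \<Longrightarrow> has_type \<Gamma> M (e j)"
    and "1 \<le> i" "i < j" "i < n \<Longrightarrow> j \<le> n"
  shows "stage2 \<Gamma> e n i j (M \<union> inst_lits (e p) (e p) \<tau>) =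
         stage2 \<Gamma> e n i j (M \<union> inst_lits (e p) (e p) \<tau>')"
  using assms(4-)
proof (induction "(n - i, n - j)" arbitrary: i j M
    rule: wf_induct_rule[OF wf_lex_prod[OF wf_less_than wf_less_than], case_names less])
  case less
  let ?K = "M \<union> inst_lits (e p) (e p) \<tau>" and ?K' = "M \<union> inst_lits (e p) (e p) \<tau>'"
  let ?L = "inst_lits (e i) (e j)"
  let ?C = "compatible \<Gamma> (assigned_type \<Gamma> ?K (e i)) (assigned_type \<Gamma> ?K (e j))"
  let ?C' = "compatible \<Gamma> (assigned_type \<Gamma> ?K' (e i)) (assigned_type \<Gamma> ?K' (e j))"
  have \<tau>: "\<tau> \<in> unary_types \<Gamma>" "\<tau>' \<in> unary_types \<Gamma>"
    using inter by (auto simp: interchangeable_def valid_types_def)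
  show ?case
  proof (cases "i < n")
    case False
    then show ?thesis by (simp add: stage2.simps)
  next
    case True
    then have ij: "i \<in> {1..n}" "j \<in> {1..n}" "i \<noteq> j" and e_ij: "e i \<noteq> e j"
      using less.prems inj by (auto simp: inj_on_eq_iff)
    have free: "diag_free (e p) (M \<union> ?L \<pi>)" if "\<pi> \<in> ?C \<or> \<pi> \<in> ?C'" for \<pi>
    proof -
      have "\<pi> \<in> binary_types \<Gamma>"
        using that by (auto dest: compatible_binary_types)
      then show ?thesis
        using less.prems(1) diag_free_binary[OF _ e_ij] by (simp add: diag_free_Un)
    qed
    \<comment> \<open>Regrouping moves the new literals into the frame, the form in which the
      exchange of extendability and the induction hypothesis apply.\<close>
    have shift: "M \<union> N \<union> ?L \<pi> = M \<union> ?L \<pi> \<union> N" for N \<pi>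
      by blast
    have ext: "extendable \<Gamma> e n (?K \<union> ?L \<pi>) \<longleftrightarrow> extendable \<Gamma> e n (?K' \<union> ?L \<pi>)"
      if "\<pi> \<in> ?C \<or> \<pi> \<in> ?C'" for \<pi>
      using extendable_exchange_iff[OF inter free[OF that]] p by (simp add: shift)
    \<comment> \<open>An extendable choice supplies the model that makes the other assigned types
      valid. If there is none, both sets of choices are empty by \<open>ext\<close>, and nothing has
      to be compared.\<close>
    have comp: "?C = ?C'" if ext_K: "extendable \<Gamma> e n (?K \<union> ?L \<pi>)" for \<pi>
    proof -
      have other: "assigned_type \<Gamma> ?K (e k) = assigned_type \<Gamma> M (e k)"
          "assigned_type \<Gamma> ?K' (e k) = assigned_type \<Gamma> M (e k)"
          "assigned_type \<Gamma> M (e k) \<in> valid_types \<Gamma>"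
        if k: "k \<in> {1..n}" "k \<noteq> p" for k
      proof -
        have "e k \<noteq> e p" using k p inj by (auto simp: inj_on_eq_iff)
        then show "assigned_type \<Gamma> ?K (e k) = assigned_type \<Gamma> M (e k)"
          "assigned_type \<Gamma> ?K' (e k) = assigned_type \<Gamma> M (e k)"
          using \<tau> by (simp_all add: assigned_type_other)
        show "assigned_type \<Gamma> M (e k) \<in> valid_types \<Gamma>"
          using k less.prems(2) by (intro assigned_type_valid[OF ext_K]) auto
      qed
      have same: "assigned_type \<Gamma> ?K (e p) = \<tau>" "assigned_type \<Gamma> ?K' (e p) = \<tau>'"
        using \<tau> less.prems(1) by (simp_all add: assigned_type_same)
      have eq: "compatible \<Gamma> \<tau> \<sigma> = compatible \<Gamma> \<tau>' \<sigma>" "compatible \<Gamma> \<sigma> \<tau> = compatible \<Gamma> \<sigma> \<tau>'"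
        if "\<sigma> \<in> valid_types \<Gamma>" for \<sigma>
      proof -
        show *: "compatible \<Gamma> \<tau> \<sigma> = compatible \<Gamma> \<tau>' \<sigma>"
          using inter that by (auto simp: interchangeable_def)
        show "compatible \<Gamma> \<sigma> \<tau> = compatible \<Gamma> \<sigma> \<tau>'"
          using compatible_eq_swap[OF valid_types_unary[OF that] \<tau> *] .
      qed
      \<comment> \<open>At most one element of the pair is \<open>e p\<close>. The first two cases
        are the two argument positions of \<open>compatible\<close>; in the third neither assigned
        type changes.\<close>
      consider "i = p" "j \<noteq> p" | "j = p" "i \<noteq> p" | "i \<noteq> p" "j \<noteq> p"
        using ij(3) by blast
      then show ?thesis
        using ij by cases (simp_all add: other same eq)
    qed
    have choices: "{\<pi> \<in> ?C. extendable \<Gamma> e n (?K \<union> ?L \<pi>)} = {\<pi> \<in> ?C'. extendable \<Gamma> e n (?K' \<union> ?L \<pi>)}"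
    proof (rule Collect_cong)
      fix \<pi>
      show "\<pi> \<in> ?C \<and> extendable \<Gamma> e n (?K \<union> ?L \<pi>) \<longleftrightarrow> \<pi> \<in> ?C' \<and> extendable \<Gamma> e n (?K' \<union> ?L \<pi>)"
      proof (cases "extendable \<Gamma> e n (?K \<union> ?L \<pi>)")
        case True
        show ?thesis using ext[of \<pi>] by (simp only: comp[OF True]) argo
      next
        case False
        then show ?thesis using ext[of \<pi>] by argo
      qed
    qed
    have next_eq:
      "stage2 \<Gamma> e n i' j' (?K \<union> ?L \<pi>) = stage2 \<Gamma> e n i' j' (?K' \<union> ?L \<pi>)"
      if "\<pi> \<in> ?C" "((n - i', n - j'), (n - i, n - j)) \<in> less_than <*lex*> less_than"
        "1 \<le> i'" "i' < j'" "i' < n \<Longrightarrow> j' \<le> n" for \<pi> i' j'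
    proof -
      have "has_type \<Gamma> (M \<union> ?L \<pi>) (e k)" if "k \<in> {1..n} - {p}" for k
        using less.prems(2)[OF that] by (rule has_type_mono)
      moreover have "diag_free (e p) (M \<union> ?L \<pi>)"
        using free that(1) by blast
      ultimately show ?thesis
        unfolding shift using that(2-) by (intro less.hyps)
    qed
    have step: "(if j < n then stage2 \<Gamma> e n i (j + 1) (?K \<union> ?L \<pi>)
             else stage2 \<Gamma> e n (i + 1) (i + 2) (?K \<union> ?L \<pi>)) =
          (if j < n then stage2 \<Gamma> e n i (j + 1) (?K' \<union> ?L \<pi>)
             else stage2 \<Gamma> e n (i + 1) (i + 2) (?K' \<union> ?L \<pi>))" if "\<pi> \<in> ?C" for \<pi>
    \<comment> \<open>Within a row the second component of the measure drops; at the end of a row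
      the first one does.\<close>
    proof (cases "j < n")
      case True
      then show ?thesis
        using next_eq[OF that, of i "j + 1"] less.prems(3,4) by simp
    next
      case False
      then show ?thesis
        using next_eq[OF that, of "i + 1" "i + 2"] \<open>i < n\<close> by simp
    qed
    show ?thesis
      unfolding stage2.simps[of \<Gamma> e n i j ?K] stage2.simps[of \<Gamma> e n i j ?K'] choices[symmetric]
      by (rule if_cong[OF refl refl], rule arg_cong[where f = mk_Or], rule image_cong[OF refl])
        (simp only: mem_Collect_eq step)
  qed
qed

text \<open>The candidates at \<open>e m\<close> are all valid types in both runs, so only
  extendability could separate them. The frame collects the types of the other elements, which
  Stage-II will look up.\<close>

lemma stage1_exchange:
  assumes inter: "interchangeable \<Gamma> \<tau> \<tau>'" and inj: "inj_on e {1..n}" and p: "p \<in> {1..n}"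
    and "diag_free (e p) M" "\<And>j. j \<in> {1..<m} - {p} \<Longrightarrow> has_type \<Gamma> M (e j)"
    and "p < m" "m \<le> n + 1"
  shows "stage1 \<Gamma> e n m (M \<union> inst_lits (e p) (e p) \<tau>) =
         stage1 \<Gamma> e n m (M \<union> inst_lits (e p) (e p) \<tau>')"
  using assms(4-)
proof (induction "n + 1 - m" arbitrary: m M)
  case 0
  then have m: "m = n + 1" by simp
  \<comment> \<open>Every element other than \<open>e p\<close> now has a type. For
    \<open>n = 1\<close> the starting pair \<open>(1, 2)\<close> meets the conditional bound
    vacuously.\<close>
  show ?case
    using 0 stage2_exchange[OF inter inj p, of M 1 2] unfolding m
    by (simp add: stage1.simps atLeastLessThanSuc_atLeastAtMost)
next
  case (Suc d)
  let ?K = "M \<union> inst_lits (e p) (e p) \<tau>" and ?K' = "M \<union> inst_lits (e p) (e p) \<tau>'"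
  let ?L = "inst_lits (e m) (e m)"
  have m: "m \<in> {1..n}" "p \<noteq> m" and e_m: "e m \<noteq> e p"
    using Suc p inj by (auto simp: inj_on_eq_iff)
  have free: "diag_free (e p) (M \<union> ?L \<sigma>)" if "\<sigma> \<in> valid_types \<Gamma>" for \<sigma>
    using Suc.prems(1) diag_free_unary[OF valid_types_unary[OF that] e_m]
    by (simp add: diag_free_Un)
  have shift: "M \<union> N \<union> ?L \<sigma> = M \<union> ?L \<sigma> \<union> N" for N \<sigma>
    by blast
  have choices: "{\<sigma> \<in> valid_types \<Gamma>. extendable \<Gamma> e n (?K \<union> ?L \<sigma>)} =
      {\<sigma> \<in> valid_types \<Gamma>. extendable \<Gamma> e n (?K' \<union> ?L \<sigma>)}"
    using extendable_exchange_iff[OF inter free] p by (auto simp: shift)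
  have step: "stage1 \<Gamma> e n (m + 1) (?K \<union> ?L \<sigma>) = stage1 \<Gamma> e n (m + 1) (?K' \<union> ?L \<sigma>)"
    if \<sigma>: "\<sigma> \<in> valid_types \<Gamma>" for \<sigma>
  proof -
    have "has_type \<Gamma> (M \<union> ?L \<sigma>) (e j)" if "j \<in> {1..<m + 1} - {p}" for j
    proof (cases "j = m")
      case True
      then show ?thesis using valid_types_unary[OF \<sigma>] by (auto simp: has_type_def)
    next
      case False
      then have "has_type \<Gamma> M (e j)" using that by (intro Suc.prems(2)) simp
      then show ?thesis by (rule has_type_mono)
    qed
    moreover have "d = n + 1 - (m + 1)" "p < m + 1" "m + 1 \<le> n + 1"
      using Suc.hyps(2) Suc.prems(3) m by simp_all
    ultimately show ?thesis
      unfolding shift using free[OF \<sigma>] by (intro Suc.hyps(1))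
  qed
  have "n + 1 \<le> m \<longleftrightarrow> False" using m by simp
  then show ?case
    unfolding stage1.simps[of \<Gamma> e n m ?K] stage1.simps[of \<Gamma> e n m ?K'] choices[symmetric]
    by (simp only: if_False, intro arg_cong[where f = mk_Or] image_cong[OF refl])
      (simp only: mem_Collect_eq step)
qed

section \<open>Contexts reached by Stage-I, and the conclusion\<close>

lemma stage1_call_context:
  assumes "stage1_call \<Gamma> e n i \<theta>"
  shows "(\<forall>j\<in>{1..<i}. has_type \<Gamma> \<theta> (e j)) \<and> i \<le> n + 1 \<and>
    (\<forall>l\<in>\<theta>. \<forall>x\<in>set_lit l. \<exists>j\<in>{1..<i}. terms_atom x = {e j})"
  using assms
proof induction
  case (step i \<theta> \<tau>)
  let ?K = "\<theta> \<union> inst_lits (e i) (e i) \<tau>"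
  have \<tau>: "\<tau> \<in> unary_types \<Gamma>"
    using step.hyps(3) by (rule valid_types_unary)
  \<comment> \<open>Positivity of \<open>i\<close> comes from the two ways in which a call arises:
    its index is 1 or a successor.\<close>
  have i: "i \<in> {1..<i + 1}"
    using step.hyps(1) by (cases rule: stage1_call.cases) simp_all
  have "has_type \<Gamma> ?K (e j)" if "j \<in> {1..<i + 1}" for j
  proof (cases "j = i")
    case True
    then show ?thesis using \<tau> unfolding has_type_def by blast
  next
    case False
    then have "has_type \<Gamma> \<theta> (e j)" using that step.IH by simp
    then show ?thesis by (rule has_type_mono)
  qed
  moreover have "\<exists>j\<in>{1..<i + 1}. terms_atom x = {e j}" if l: "l \<in> ?K" and x: "x \<in> set_lit l" for l x
  proof (cases "l \<in> \<theta>")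
    case True
    then obtain j where "j \<in> {1..<i}" "terms_atom x = {e j}"
      using step.IH x by blast
    then show ?thesis by (intro bexI[of _ j]) simp_all
  next
    case False
    then have "terms_atom x = {e i}"
      using l by (intro unary_inst_terms[OF \<tau> _ x]) simp
    then show ?thesis using i by (rule bexI)
  qed
  moreover have "i + 1 \<le> n + 1"
    using step.hyps(2) by simp
  ultimately show ?case by (intro conjI ballI)
qed simp

theorem proposition20:
  fixes \<Gamma> :: "('u, 'b) scott" and e :: "nat \<Rightarrow> 'e" and n i :: nat
    and \<theta> :: "('u, 'b, 'e) atom lit set" and \<tau> \<tau>' :: "('u, 'b, var) atom lit set"
  assumes "scott_normal_form \<Gamma>"
    and "n \<ge> 1" and "inj_on e {1..n}"
    and "i \<in> {1..n}"
    and "stage1_call \<Gamma> e n i \<theta>"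
    and "\<tau> \<in> valid_types \<Gamma>" and "\<tau>' \<in> valid_types \<Gamma>"
    and "\<And>k. k \<in> {1..num_ex \<Gamma>} \<Longrightarrow>
           Pos (inst_atom X X (beta \<Gamma> k)) \<in> \<tau> \<longleftrightarrow> Pos (inst_atom X X (beta \<Gamma> k)) \<in> \<tau>'"
    and "\<And>\<tau>''. \<tau>'' \<in> valid_types \<Gamma> \<Longrightarrow> compatible \<Gamma> \<tau> \<tau>'' = compatible \<Gamma> \<tau>' \<tau>''"
  shows "circuits_equivalent (ground_atoms \<Gamma> (e ` {1..n}))
           (stage1 \<Gamma> e n (i + 1) (\<theta> \<union> inst_lits (e i) (e i) \<tau>))
           (stage1 \<Gamma> e n (i + 1) (\<theta> \<union> inst_lits (e i) (e i) \<tau>'))"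
proof -
  have inter: "interchangeable \<Gamma> \<tau> \<tau>'"
    using assms(6-9) by (simp add: interchangeable_def)
  have ctx: "\<forall>j\<in>{1..<i}. has_type \<Gamma> \<theta> (e j)"
    "\<forall>l\<in>\<theta>. \<forall>x\<in>set_lit l. \<exists>j\<in>{1..<i}. terms_atom x = {e j}"
    using stage1_call_context[OF assms(5)] by auto
  \<comment> \<open>By injectivity the context speaks only of elements other than
    \<open>e i\<close>, so it can serve as the frame.\<close>
  have "e j \<noteq> e i" if "j \<in> {1..<i}" for j
    using that assms(3,4) by (auto simp: inj_on_eq_iff)
  then have "{e j} \<noteq> {e i}" if "j \<in> {1..<i}" for j
    using that by blast
  then have "diag_free (e i) \<theta>"
    using ctx(2) unfolding diag_free_def by metis
  then have "stage1 \<Gamma> e n (i + 1) (\<theta> \<union> inst_lits (e i) (e i) \<tau>) =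
      stage1 \<Gamma> e n (i + 1) (\<theta> \<union> inst_lits (e i) (e i) \<tau>')"
    using assms(4) ctx(1) by (intro stage1_exchange[OF inter assms(3,4)]) auto
  then show ?thesis by (simp add: circuits_equivalent_def)
qed

end
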